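(* Let $M,m,A,A_1,B,B_1>0$ and let $C>0$ be the magnitude of the angular momentum in the isosceles Schwarzschild three body problem (reduced Hamiltonian $H_{\mathrm{red}}$ given in the context). Put $\alpha:=M(A+4A_1)$, $\beta:=M(B+16B_1)$ and $C_0:=\sqrt[4]{3\alpha\beta}$. Then: 1. If $C<C_0$, there are no relative equilibria. 2. If $C=C_0$, there is exactly one relative equilibrium; it is of collinear configuration ($z=0$), with the equal point masses situated at $R_0=\dfrac{C^2}{\alpha}$. This relative equilibrium is of degenerate stability: the linearization there has a zero pair of eigenvalues. 3. If $C>C_0$, there are exactly two relative equilibria, both of collinear configuration, with the equal point masses situated at $(R,z)=(R_i,0)$, $i=1,2$, where $$R_1=\frac{C^2+\sqrt{C^4-C_0^4}}{\alpha},\qquad R_2=\frac{C^2-\sqrt{C^4-C_0^4}}{\alpha}.$$ The relative equilibrium $(R_1,0)$ is nonlinearly stable modulo rotations, whereas $(R_2,0)$ is unstable.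
   Context: The isosceles Schwarzschild problem: two equal point masses $M$ move in a horizontal plane, symmetrically with respect to their midpoint $O$, and a third point mass $m$ moves on the vertical axis through $O$; the mutual interactions are given by potentials of the form $-a/\rho-b/\rho^3$. Let $R>0$ be the distance between the equal masses and $z\in\mathbb R$ the signed height of $m$ above $O$. After reduction by rotations about the vertical axis, with $C$ the conserved angular momentum, the motion is given by the two degree of freedom Hamiltonian system on $\{(R,z,P_R,P_z): R>0\}$ with canonical equations for $$H_{\mathrm{red}}(R,z,P_R,P_z;C)=\frac1M P_R^2+\frac{2M+m}{4Mm}P_z^2+U_{\mathrm{eff}}(R,z;C),$$ $$U_{\mathrm{eff}}(R,z;C)=\frac{C^2}{MR^2}-\frac{A}{R}-\frac{B}{R^3}-\frac{4A_1}{(R^2+4z^2)^{1/2}}-\frac{16B_1}{(R^2+4z^2)^{3/2}}.$$ A relative equilibrium with angular momentum $C$ is an equilibrium of this reduced system, i.e. a critical point $(R,z)$ of $U_{\mathrm{eff}}(\cdot,\cdot;C)$ together with $P_R=P_z=0$. Nonlinear stability modulo rotations means Lyapunov stability of the equilibrium for the reduced system; unstable means that the equilibrium of the reduced system is unstable. The linearization is that of the reduced Hamiltonian vector field. *)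

theory Defs
  imports "HOL-Analysis.Analysis" "HOL-Computational_Algebra.Polynomial"
begin


definition solution_on ::
  "'a::real_normed_vector set \<Rightarrow> ('a \<Rightarrow> 'a) \<Rightarrow> real set \<Rightarrow> (real \<Rightarrow> 'a) \<Rightarrow> bool" where
  "solution_on S X J \<gamma> \<longleftrightarrow>
     (\<forall>t\<in>J. \<gamma> t \<in> S \<and> (\<gamma> has_vector_derivative X (\<gamma> t)) (at t within J))"

definition equilibrium :: "'a::real_normed_vector set \<Rightarrow> ('a \<Rightarrow> 'a) \<Rightarrow> 'a \<Rightarrow> bool" where
  "equilibrium S X p \<longleftrightarrow> p \<in> S \<and> X p = 0"

text \<open>
  Motions starting close to \<open>p\<close> exist for all forward time and stay close to \<open>p\<close>.
  The second clause ranges over solutions on arbitrary compact forward time intervals, so that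
  a motion that leaves the neighbourhood violates it even if it ceases to exist afterwards.
\<close>

definition lyapunov_stable :: "'a::real_normed_vector set \<Rightarrow> ('a \<Rightarrow> 'a) \<Rightarrow> 'a \<Rightarrow> bool" where
  "lyapunov_stable S X p \<longleftrightarrow>
     (\<forall>\<epsilon>>0. \<exists>\<delta>>0. \<forall>x\<in>S. dist x p < \<delta> \<longrightarrow>
        (\<exists>\<gamma>. solution_on S X {0..} \<gamma> \<and> \<gamma> 0 = x) \<and>
        (\<forall>T\<ge>0. \<forall>\<gamma>. solution_on S X {0..T} \<gamma> \<and> \<gamma> 0 = x \<longrightarrow>
           (\<forall>t\<in>{0..T}. dist (\<gamma> t) p < \<epsilon>)))"

definition charpoly :: "real^'n^'n \<Rightarrow> real poly" where
  "charpoly K = det (\<chi> i j. (if i = j then [:0, 1:] else 0) - [:K $ i $ j:])"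

text \<open>
  Algebraic multiplicity of \<open>a\<close> as an eigenvalue of the linearization of \<open>X\<close> at \<open>p\<close>;
  it is \<open>0\<close> if \<open>a\<close> is not an eigenvalue.
\<close>

definition linearization_multiplicity :: "(real^'n \<Rightarrow> real^'n) \<Rightarrow> real^'n \<Rightarrow> real \<Rightarrow> nat" where
  "linearization_multiplicity X p a = order a (charpoly (jacobian X (at p)))"



text \<open>Points of phase space are \<open>(R, z, P\<^sub>R, P\<^sub>z)\<close>, in this order.\<close>

definition phase_space :: "(real^4) set" where
  "phase_space = {x. x $ 1 > 0}"

definition hamiltonian_vf :: "(real \<Rightarrow> real \<Rightarrow> real \<Rightarrow> real \<Rightarrow> real) \<Rightarrow> real^4 \<Rightarrow> real^4" where
  "hamiltonian_vf H x = vector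
     [  deriv (\<lambda>p. H (x $ 1) (x $ 2) p (x $ 4)) (x $ 3),
        deriv (\<lambda>p. H (x $ 1) (x $ 2) (x $ 3) p) (x $ 4),
      - deriv (\<lambda>q. H q (x $ 2) (x $ 3) (x $ 4)) (x $ 1),
      - deriv (\<lambda>q. H (x $ 1) q (x $ 3) (x $ 4)) (x $ 2)]"

definition U_eff ::
  "real \<Rightarrow> real \<Rightarrow> real \<Rightarrow> real \<Rightarrow> real \<Rightarrow> real \<Rightarrow> real \<Rightarrow> real \<Rightarrow> real" where
  "U_eff M A B A1 B1 C R z =
     C^2 / (M * R^2) - A / R - B / R^3
     - 4 * A1 / (R^2 + 4 * z^2) powr (1/2)
     - 16 * B1 / (R^2 + 4 * z^2) powr (3/2)"

definition H_red ::
  "real \<Rightarrow> real \<Rightarrow> real \<Rightarrow> real \<Rightarrow> real \<Rightarrow> real \<Rightarrow> real \<Rightarrow>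
   real \<Rightarrow> real \<Rightarrow> real \<Rightarrow> real \<Rightarrow> real" where
  "H_red M m A B A1 B1 C R z P\<^sub>R P\<^sub>z =
     1 / M * P\<^sub>R^2 + (2 * M + m) / (4 * M * m) * P\<^sub>z^2 + U_eff M A B A1 B1 C R z"

definition X_red ::
  "real \<Rightarrow> real \<Rightarrow> real \<Rightarrow> real \<Rightarrow> real \<Rightarrow> real \<Rightarrow> real \<Rightarrow> real^4 \<Rightarrow> real^4" where
  "X_red M m A B A1 B1 C = hamiltonian_vf (H_red M m A B A1 B1 C)"

definition relative_equilibria ::
  "real \<Rightarrow> real \<Rightarrow> real \<Rightarrow> real \<Rightarrow> real \<Rightarrow> real \<Rightarrow> real \<Rightarrow> (real^4) set" where
  "relative_equilibria M m A B A1 B1 C =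
     {x. equilibrium phase_space (X_red M m A B A1 B1 C) x}"

text \<open>The phase point with configuration \<open>(R, z)\<close> and \<open>P\<^sub>R = P\<^sub>z = 0\<close>.\<close>

definition rest_point :: "real \<Rightarrow> real \<Rightarrow> real^4" where
  "rest_point R z = vector [R, z, 0, 0]"

lemma hamiltonian_vf_H_red:
  assumes "M > 0" "m > 0"
  shows "X_red M m A B A1 B1 C x = vector
    [2 / M * x $ 3,
     (2 * M + m) / (2 * M * m) * x $ 4,
     - deriv (\<lambda>q. U_eff M A B A1 B1 C q (x $ 2)) (x $ 1),
     - deriv (\<lambda>q. U_eff M A B A1 B1 C (x $ 1) q) (x $ 2)]"
proof -
  have a: "deriv (\<lambda>p. 1 / M * p^2 + u + v) y = 2 / M * y" for u v y :: real
    using assms by (intro DERIV_imp_deriv) (auto intro!: derivative_eq_intros)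
  have b: "deriv (\<lambda>p. u + (2 * M + m) / (4 * M * m) * p^2 + v) y
             = (2 * M + m) / (2 * M * m) * y" for u v y :: real
    using assms by (intro DERIV_imp_deriv) (auto intro!: derivative_eq_intros simp: field_simps)
  have c: "deriv (\<lambda>q. u + f q) y = deriv f y" for u y :: real and f
  proof -
    have "((\<lambda>q. u + f q) has_field_derivative D) (at y) \<longleftrightarrow> (f has_field_derivative D) (at y)" for D
      using DERIV_add[of "\<lambda>q. u + f q" D y UNIV "\<lambda>_. - u" 0] DERIV_add[of f D y UNIV "\<lambda>_. u" 0]
      by (auto simp: add.commute)
    then show ?thesis by (simp add: deriv_def)
  qed
  show ?thesis
    unfolding X_red_def hamiltonian_vf_def H_red_def a b c ..
qed

lemma mem_relative_equilibria_iff: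
  assumes "M > 0" "m > 0"
  shows "x \<in> relative_equilibria M m A B A1 B1 C \<longleftrightarrow>
    x $ 1 > 0 \<and> x $ 3 = 0 \<and> x $ 4 = 0 \<and>
    deriv (\<lambda>q. U_eff M A B A1 B1 C q (x $ 2)) (x $ 1) = 0 \<and>
    deriv (\<lambda>q. U_eff M A B A1 B1 C (x $ 1) q) (x $ 2) = 0"
proof -
  have v: "vector [a, b, c, d] = (0 :: real^4) \<longleftrightarrow> a = 0 \<and> b = 0 \<and> c = 0 \<and> d = 0" for a b c d
    by (simp add: vec_eq_iff forall_4 vector_def)
  have "2 * M + m \<noteq> 0" using assms by simp
  then show ?thesis
    using assms unfolding relative_equilibria_def equilibrium_def phase_space_def
      hamiltonian_vf_H_red[OF assms] by (auto simp: v)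
qed

end

theory Submission
  imports Defs
begin

text \<open>
  The attraction exerted by the two equal masses always pulls \<open>m\<close> back to their plane, so
  \<open>\<partial>U/\<partial>z\<close> vanishes only for \<open>z = 0\<close> and every relative equilibrium is collinear.
  On \<open>z = 0\<close>, clearing denominators in \<open>\<partial>U/\<partial>R = 0\<close> leaves the quadratic equation
  \<open>\<alpha> R\<^sup>2 - 2 C\<^sup>2 R + 3 \<beta> = 0\<close>, that is \<open>(\<alpha> R - C\<^sup>2)\<^sup>2 = C\<^sup>4 - C0\<^sup>4\<close>
  (lemmas \<open>U_R_collinear\<close> and \<open>relative_equilibria_eq\<close>). This gives the number and the positions
  of the equilibria.

  At a collinear equilibrium the mixed derivative of \<open>U\<close> vanishes, so the linearization splits into
  two second order equations and its characteristic polynomial is a product of two factors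
  \<open>\<lambda>\<^sup>2 + const\<close>. At \<open>C = C0\<close> the radial constant vanishes because the quadratic has a
  double root, while the vertical one is positive; hence \<open>0\<close> has multiplicity exactly two
  (\<open>degenerate_linearization\<close>).

  For \<open>C > C0\<close> the function \<open>R \<mapsto> U(R, 0)\<close> decreases from \<open>R2\<close> to \<open>R1\<close> and increases
  beyond \<open>R1\<close>. Since \<open>U(R, z) \<ge> U(R, 0)\<close>, the energy has a strict local minimum at \<open>(R1, 0)\<close>
  and the Lagrange-Dirichlet theorem (\<open>lyapunov_stable_strict_minimum_of_conserved\<close>) gives
  stability. Stability includes forward existence of all nearby motions; this is obtained by
  truncating the vector field outside a ball, solving the truncated equation globally with the
  contraction principle, and noting that the energy barrier keeps the solution where nothing
  was changed.

  For \<open>(R2, 0)\<close> a motion is released at rest from \<open>(R2 + s, 0)\<close>. Energy conservation and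
  \<open>U(R, z) \<ge> U(R, 0)\<close> prevent \<open>R\<close> from returning below \<open>R2 + s\<close>, whatever \<open>z\<close> does, and there
  \<open>P\<^sub>R' = - \<partial>U/\<partial>R(R, z) \<ge> - \<partial>U/\<partial>R(R, 0)\<close> is bounded below by a positive constant as
  long as \<open>R\<close> stays near \<open>R2\<close>. So \<open>P\<^sub>R\<close> cannot remain small (\<open>not_lyapunov_stable_rest_point\<close>).
\<close>

section \<open>The Lagrange-Dirichlet stability theorem\<close>

text \<open>
  Picard iteration on the whole half line at once. Writing \<open>\<gamma> t = x + exp (K t) y t\<close> turns the integral
  equation into a fixed point equation for a bounded continuous \<open>y\<close>, and in the supremum norm
  the map has Lipschitz constant \<open>L / K\<close>. Boundedness of \<open>F\<close> makes the map preserve bounded functions.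
\<close>

lemma bounded_lipschitz_field_global_solution:
  fixes F :: "'a::banach \<Rightarrow> 'a"
  assumes lip: "L-lipschitz_on UNIV F" and bound: "\<And>x. norm (F x) \<le> b"
  obtains \<gamma> where "solution_on UNIV F {0..} \<gamma>" "\<gamma> 0 = x"
proof -
  \<comment> \<open>the weight has to outgrow the Lipschitz constant: every \<open>K > L\<close> gives a contraction\<close>
  define K where "K = 2 * L + 1"
  have L: "L \<ge> 0" using lip by (rule lipschitz_on_nonneg)
  then have K: "K > 0" "L / K < 1" by (auto simp: K_def divide_simps)
  have b: "b \<ge> 0" using bound[of 0] norm_ge_zero order_trans by blast
  have contF: "continuous_on UNIV F" using lip by (rule lipschitz_on_continuous_on)
  define v where "v y s = F (x + exp (K * s) *\<^sub>R apply_bcontfun y s)" for y :: "real \<Rightarrow>\<^sub>C 'a" and s :: real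
  \<comment> \<open>freezing negative times at \<open>0\<close> makes the map act on functions on the whole line\<close>
  define G where "G y t = exp (- (K * max 0 t)) *\<^sub>R integral {0..max 0 t} (v y)" for y t
  have contv: "continuous_on S (v y)" for y S
    unfolding v_def by (intro continuous_on_compose2[OF contF] continuous_intros) auto
  have deriv: "((\<lambda>u. integral {0..u} (v y)) has_vector_derivative v y t) (at t within {0..})"
    if "t \<ge> 0" for y t
  proof -
    have "((\<lambda>u. integral {0..u} (v y)) has_vector_derivative v y t) (at t within {0..t + 1})"
      using that by (intro integral_has_vector_derivative contv) auto
    moreover have "at t within {0..t + 1} = at t within {0..}"
      by (rule at_within_nhd[where S = "{..<t + 1}"]) auto
    ultimately show ?thesis by simp
  qed
  have contG: "continuous_on UNIV (G y)" for y
  proof -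
    have "continuous_on {0..} (\<lambda>u. integral {0..u} (v y))"
      by (rule continuous_on_vector_derivative[where f' = "v y"]) (simp add: deriv)
    then have "continuous_on UNIV (\<lambda>t. integral {0..max 0 t} (v y))"
      by (rule continuous_on_compose2[where f = "max 0"]) (auto intro!: continuous_intros)
    then show ?thesis unfolding G_def by (intro continuous_intros)
  qed
  \<comment> \<open>the weight wins over the linear growth of the integral, as \<open>K u \<le> exp (K u)\<close>\<close>
  have normG: "norm (G y t) \<le> b / K" for y t
  proof -
    define u where "u = max 0 t"
    have u: "u \<ge> 0" by (simp add: u_def)
    have "norm (integral {0..u} (v y)) \<le> b * (u - 0)"
      using u by (intro integral_bound contv) (auto simp: v_def bound)
    then have "norm (G y t) \<le> exp (- (K * u)) * (b * u)"
      by (simp add: G_def u_def mult_left_mono)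
    also have "\<dots> \<le> b / K"
    proof -
      have "K * u \<le> exp (K * u)" using exp_ge_add_one_self[of "K * u"] by linarith
      then have "b * (K * u) \<le> b * exp (K * u)" using b by (rule mult_left_mono)
      then show ?thesis using K by (simp add: exp_minus field_simps)
    qed
    finally show ?thesis .
  qed
  have "G y \<in> bcontfun" for y
    using contG normG by (auto simp: bcontfun_def bounded_iff)
  then have app: "apply_bcontfun (Bcontfun (G y)) = G y" for y
    by (rule Bcontfun_inverse)
  have "dist (Bcontfun (G y)) (Bcontfun (G w)) \<le> (L / K) * dist y w" for y w
  proof (rule dist_bound)
    fix t :: real
    define u where "u = max 0 t"
    have u: "u \<ge> 0" by (simp add: u_def)
    define d where "d = dist y w"
    have exp_int: "((\<lambda>s. L * d * exp (K * s)) has_integral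
        (L * d / K * exp (K * u) - L * d / K * exp (K * 0))) {0..u}"
    proof (rule fundamental_theorem_of_calculus[OF u])
      fix s
      show "((\<lambda>s. L * d / K * exp (K * s)) has_vector_derivative L * d * exp (K * s)) (at s within {0..u})"
        unfolding has_real_derivative_iff_has_vector_derivative[symmetric]
        using K by (auto intro!: derivative_eq_intros)
    qed
    have pt: "norm (v y s - v w s) \<le> L * d * exp (K * s)" for s
    proof -
      have "norm (v y s - v w s) \<le> L * norm (exp (K * s) *\<^sub>R (apply_bcontfun y s - apply_bcontfun w s))"
        using lipschitz_on_normD[OF lip, of "x + exp (K * s) *\<^sub>R apply_bcontfun y s"
            "x + exp (K * s) *\<^sub>R apply_bcontfun w s"]
        by (simp add: v_def scaleR_diff_right)
      also have "\<dots> = L * (exp (K * s) * dist (apply_bcontfun y s) (apply_bcontfun w s))"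
        by (simp add: dist_norm)
      also have "\<dots> \<le> L * (exp (K * s) * d)"
        unfolding d_def by (intro mult_left_mono dist_bounded L) auto
      finally show ?thesis by (simp add: ac_simps)
    qed
    have "integral {0..u} (v y) - integral {0..u} (v w) = integral {0..u} (\<lambda>s. v y s - v w s)"
      by (intro integral_diff[symmetric] integrable_continuous_real contv)
    also have "norm \<dots> \<le> integral {0..u} (\<lambda>s. L * d * exp (K * s))"
      using exp_int pt
      by (intro integral_norm_bound_integral integrable_continuous_real continuous_intros contv)
         (auto simp: has_integral_integrable)
    also have "\<dots> = L * d / K * exp (K * u) - L * d / K * exp (K * 0)"
      using exp_int by (rule integral_unique)
    also have "\<dots> \<le> L * d / K * exp (K * u)"
      using L K by (simp add: d_def)
    finally have "norm (integral {0..u} (v y) - integral {0..u} (v w)) \<le> L * d / K * exp (K * u)" .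
    then have "exp (- (K * u)) * norm (integral {0..u} (v y) - integral {0..u} (v w))
        \<le> exp (- (K * u)) * (L * d / K * exp (K * u))"
      by (rule mult_left_mono) auto
    also have "\<dots> = L / K * d" by (simp add: exp_minus field_simps)
    finally show "dist (apply_bcontfun (Bcontfun (G y)) t) (apply_bcontfun (Bcontfun (G w)) t)
        \<le> L / K * dist y w"
      by (simp add: app G_def dist_norm scaleR_diff_right[symmetric] u_def d_def)
  qed
  then obtain y where "Bcontfun (G y) = y"
    using banach_fix_type[of "L / K" "\<lambda>y. Bcontfun (G y)"] L K by auto
  then have fix_y: "apply_bcontfun y = G y" using app by metis
  define \<gamma> where "\<gamma> t = x + integral {0..t} (v y)" for t
  have "v y t = F (\<gamma> t)" if "t \<ge> 0" for t
    using that by (simp add: v_def \<gamma>_def fix_y G_def exp_minus)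
  then have "solution_on UNIV F {0..} \<gamma>"
    using deriv[of _ y] unfolding solution_on_def \<gamma>_def
    by (auto simp: has_vector_derivative_add_const add.commute[of x])
  moreover have "\<gamma> 0 = x" by (simp add: \<gamma>_def)
  ultimately show ?thesis by (rule that)
qed

text \<open>
  Up to the first time at which the curve hits the sphere of radius \<open>r\<close> it is a solution of \<open>X\<close> in \<open>S\<close>, so
  \<open>H\<close> still has its initial value, which is below all values on the sphere. Allowing a field \<open>F\<close>
  that agrees with \<open>X\<close> only on the ball makes the lemma apply both to solutions of \<open>X\<close> and to
  solutions of its truncation.
\<close>

lemma energy_barrier:
  fixes p :: "'a::real_normed_vector" and H :: "'a \<Rightarrow> real"
  assumes conserved: "\<And>T \<gamma>. T \<ge> 0 \<Longrightarrow> solution_on S X {0..T} \<gamma> \<Longrightarrow> H (\<gamma> T) = H (\<gamma> 0)"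
    and inside: "cball p r \<subseteq> S" and FX: "\<And>x. x \<in> cball p r \<Longrightarrow> F x = X x"
    and sphere: "\<And>x. dist x p = r \<Longrightarrow> c \<le> H x"
    and sol: "solution_on UNIV F {0..T} \<gamma>"
    and start: "dist (\<gamma> 0) p < r" "H (\<gamma> 0) < c"
    and t: "t \<in> {0..T}"
  shows "dist (\<gamma> t) p < r"
proof (rule ccontr)
  assume "\<not> dist (\<gamma> t) p < r"
  have cont\<gamma>: "continuous_on {0..T} \<gamma>"
    using sol by (intro continuous_on_vector_derivative[where f' = "\<lambda>t. F (\<gamma> t)"]) (auto simp: solution_on_def)
  have cont: "continuous_on {0..s} (\<lambda>u. dist (\<gamma> u) p)" if "s \<le> T" for s
    using that by (intro continuous_on_dist continuous_on_const continuous_on_subset[OF cont\<gamma>]) auto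
  \<comment> \<open>the hitting times of the sphere; the least one gives the contradiction\<close>
  define K where "K = {u \<in> {0..t}. dist (\<gamma> u) p = r}"
  have hit: "\<exists>u\<ge>0. u \<le> s \<and> dist (\<gamma> u) p = r" if "0 \<le> s" "s \<le> T" "r \<le> dist (\<gamma> s) p" for s
    using IVT'[of "\<lambda>u. dist (\<gamma> u) p" 0 r s] start that cont by auto
  have "K \<noteq> {}" using hit[of t] t \<open>\<not> dist (\<gamma> t) p < r\<close> by (auto simp: K_def)
  moreover have "compact K"
  proof -
    have "closed ({0..t} \<inter> (\<lambda>u. dist (\<gamma> u) p) -` {r})"
      using cont[of t] t by (intro continuous_closed_preimage) auto
    moreover have "K = {0..t} \<inter> (\<lambda>u. dist (\<gamma> u) p) -` {r}" by (auto simp: K_def)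
    ultimately show ?thesis
      using bounded_subset[of "{0..t}" K] by (auto simp: compact_eq_bounded_closed)
  qed
  ultimately obtain t0 where t0: "t0 \<in> K" and first: "\<And>u. u \<in> K \<Longrightarrow> t0 \<le> u"
    using compact_attains_inf by metis
  have "dist (\<gamma> u) p \<le> r" if "u \<in> {0..t0}" for u
  proof (rule ccontr)
    assume "\<not> dist (\<gamma> u) p \<le> r"
    with hit[of u] that t t0 obtain u' where "0 \<le> u'" "u' \<le> u" "dist (\<gamma> u') p = r"
      by (auto simp: K_def)
    with first[of u'] that t0 have "u' = u" by (auto simp: K_def)
    with \<open>dist (\<gamma> u') p = r\<close> \<open>\<not> dist (\<gamma> u) p \<le> r\<close> show False by simp
  qed
  then have "\<gamma> u \<in> cball p r" if "u \<in> {0..t0}" for u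
    using that by (simp add: dist_commute)
  moreover have "(\<gamma> has_vector_derivative F (\<gamma> u)) (at u within {0..t0})" if "u \<in> {0..t0}" for u
  proof (rule has_vector_derivative_within_subset)
    show "(\<gamma> has_vector_derivative F (\<gamma> u)) (at u within {0..T})"
      using sol that t0 t by (auto simp: solution_on_def K_def)
    show "{0..t0} \<subseteq> {0..T}" using t0 t by (auto simp: K_def)
  qed
  ultimately have "solution_on S X {0..t0} \<gamma>"
    using inside FX unfolding solution_on_def by (metis subsetD)
  then have "H (\<gamma> t0) = H (\<gamma> 0)" using t0 by (intro conserved) (auto simp: K_def)
  then show False using sphere[of "\<gamma> t0"] t0 start by (auto simp: K_def)
qed

text \<open>
  Nearby solutions of \<open>X\<close> are confined by \<open>energy_barrier\<close>. Their existence for all forward time comes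
  from the field \<open>X \<circ> closest_point\<close>, which is bounded and globally Lipschitz because the projection
  onto a ball does not increase distances; its solutions are confined as well and therefore solve \<open>X\<close>.
\<close>

theorem lyapunov_stable_strict_minimum_of_conserved:
  fixes p :: "'a::euclidean_space" and H :: "'a \<Rightarrow> real"
  assumes r0: "r0 > 0" "cball p r0 \<subseteq> S"
    and lip: "L-lipschitz_on (cball p r0) X"
    and contH: "continuous_on (cball p r0) H"
    and min: "\<And>x. x \<in> cball p r0 \<Longrightarrow> x \<noteq> p \<Longrightarrow> H p < H x"
    and conserved: "\<And>T \<gamma>. T \<ge> 0 \<Longrightarrow> solution_on S X {0..T} \<gamma> \<Longrightarrow> H (\<gamma> T) = H (\<gamma> 0)"
  shows "lyapunov_stable S X p"
  unfolding lyapunov_stable_def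
proof (intro allI impI)
  fix \<epsilon> :: real assume "\<epsilon> > 0"
  define r where "r = min \<epsilon> r0"
  have r: "r > 0" "r \<le> \<epsilon>" "cball p r \<subseteq> cball p r0" "cball p r \<subseteq> S"
    using \<open>\<epsilon> > 0\<close> r0 by (auto simp: r_def)
  obtain c where c: "H p < c" "\<And>x. dist x p = r \<Longrightarrow> c \<le> H x"
  proof -
    have "sphere p r \<noteq> {}" using r by simp
    moreover have "continuous_on (sphere p r) H"
      using contH r(3) by (rule continuous_on_subset[OF _ subset_trans[OF sphere_cball]])
    ultimately obtain a where a: "a \<in> sphere p r" "\<And>x. x \<in> sphere p r \<Longrightarrow> H a \<le> H x"
      using continuous_attains_inf[OF compact_sphere] by metis
    moreover have "H p < H a" using a(1) r by (intro min) auto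
    ultimately show ?thesis using that[of "H a"] by (auto simp: dist_commute)
  qed
  obtain d where d: "d > 0" "\<And>x. x \<in> cball p r0 \<Longrightarrow> dist x p < d \<Longrightarrow> H x < c"
  proof -
    obtain d where "d > 0" "\<forall>x\<in>cball p r0. dist x p < d \<longrightarrow> dist (H x) (H p) < c - H p"
      using contH[unfolded continuous_on_iff, rule_format, of p "c - H p"] c r0 by auto
    then show ?thesis by (intro that[of d]) (auto simp: dist_real_def)
  qed
  define \<delta> where "\<delta> = min d r"
  define F where "F x = X (closest_point (cball p r) x)" for x
  have FX: "F x = X x" if "x \<in> cball p r" for x
    using that by (simp add: F_def closest_point_self)
  have proj: "closest_point (cball p r) x \<in> cball p r" for x
    using r by (intro closest_point_in_set) auto
  have lipX: "L-lipschitz_on (cball p r) X" using lip r(3) by (rule lipschitz_on_subset)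
  have lipF: "L-lipschitz_on UNIV F"
  proof (rule lipschitz_onI)
    fix x y
    have "dist (F x) (F y) \<le> L * dist (closest_point (cball p r) x) (closest_point (cball p r) y)"
      unfolding F_def by (rule lipschitz_onD[OF lipX proj proj])
    also have "\<dots> \<le> L * dist x y"
      using r lipschitz_on_nonneg[OF lip] by (intro mult_left_mono closest_point_lipschitz) auto
    finally show "dist (F x) (F y) \<le> L * dist x y" .
  qed (rule lipschitz_on_nonneg[OF lip])
  have "bounded (X ` cball p r)"
    using lipX by (intro compact_imp_bounded compact_continuous_image lipschitz_on_continuous_on) auto
  then obtain b where "\<And>x. x \<in> cball p r \<Longrightarrow> norm (X x) \<le> b" unfolding bounded_iff by blast
  then have boundF: "norm (F x) \<le> b" for x using proj by (simp add: F_def)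
  show "\<exists>\<delta>>0. \<forall>x\<in>S. dist x p < \<delta> \<longrightarrow>
        (\<exists>\<gamma>. solution_on S X {0..} \<gamma> \<and> \<gamma> 0 = x) \<and>
        (\<forall>T\<ge>0. \<forall>\<gamma>. solution_on S X {0..T} \<gamma> \<and> \<gamma> 0 = x \<longrightarrow>
           (\<forall>t\<in>{0..T}. dist (\<gamma> t) p < \<epsilon>))"
  proof (intro exI[of _ \<delta>] conjI ballI impI allI)
    show "\<delta> > 0" using d r by (simp add: \<delta>_def)
    fix x assume x: "x \<in> S" "dist x p < \<delta>"
    then have "x \<in> cball p r" by (simp add: \<delta>_def dist_commute)
    then have "x \<in> cball p r0" using r(3) by blast
    with x d have start: "dist x p < r" "H x < c" by (auto simp: \<delta>_def)
    have trapped: "dist (\<gamma> t) p < r"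
      if "solution_on UNIV F' {0..T} \<gamma>" "\<gamma> 0 = x" "t \<in> {0..T}" "\<And>y. y \<in> cball p r \<Longrightarrow> F' y = X y"
      for F' T \<gamma> t
    proof (rule energy_barrier[where S = S and X = X and H = H and F = F' and c = c and T = T])
      show "dist (\<gamma> 0) p < r" "H (\<gamma> 0) < c" using start that(2) by simp_all
    qed (fact conserved r(4) c(2) that)+
    show "\<exists>\<gamma>. solution_on S X {0..} \<gamma> \<and> \<gamma> 0 = x"
    proof -
      obtain \<gamma> where \<gamma>: "solution_on UNIV F {0..} \<gamma>" "\<gamma> 0 = x"
        using bounded_lipschitz_field_global_solution[OF lipF boundF] by metis
      have inside: "\<gamma> t \<in> cball p r" if "t \<ge> 0" for t
      proof -
        have "solution_on UNIV F {0..t} \<gamma>"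
          using \<gamma> unfolding solution_on_def
          by (auto intro: has_vector_derivative_within_subset[where S = "{0..}"])
        then have "dist (\<gamma> t) p < r"
          by (rule trapped) (simp_all add: \<gamma> that FX)
        then show ?thesis by (simp add: dist_commute)
      qed
      have "solution_on S X {0..} \<gamma>"
        unfolding solution_on_def
      proof
        fix t :: real assume "t \<in> {0..}"
        then have "\<gamma> t \<in> cball p r" using inside by simp
        moreover have "(\<gamma> has_vector_derivative F (\<gamma> t)) (at t within {0..})"
          using \<gamma>(1) \<open>t \<in> {0..}\<close> by (simp add: solution_on_def)
        ultimately show "\<gamma> t \<in> S \<and> (\<gamma> has_vector_derivative X (\<gamma> t)) (at t within {0..})"
          using r(4) FX by auto
      qed
      with \<gamma> show ?thesis by blast
    qed
    fix T t :: real and \<gamma> assume T: "T \<ge> 0" and \<gamma>: "solution_on S X {0..T} \<gamma> \<and> \<gamma> 0 = x" and t: "t \<in> {0..T}"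
    then have "solution_on UNIV X {0..T} \<gamma>" by (simp add: solution_on_def)
    then have "dist (\<gamma> t) p < r"
      by (rule trapped) (use \<gamma> t in simp_all)
    then show "dist (\<gamma> t) p < \<epsilon>" using r by simp
  qed
qed

section \<open>Linear algebra in four dimensions\<close>

lemma vector_4:
  "(vector [a, b, c, d] :: 'a::zero^4) $ 1 = a"
  "(vector [a, b, c, d] :: 'a^4) $ 2 = b"
  "(vector [a, b, c, d] :: 'a^4) $ 3 = c"
  "(vector [a, b, c, d] :: 'a^4) $ 4 = d"
  by (simp_all add: vector_def)

lemma rest_point_nth:
  "rest_point R z $ 1 = R" "rest_point R z $ 2 = z" "rest_point R z $ 3 = 0" "rest_point R z $ 4 = 0"
  by (simp_all add: rest_point_def vector_4)

lemma abs_nth_diff_le_dist: "\<bar>x $ i - y $ i\<bar> \<le> dist x y" for x y :: "real^'n"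
  using component_le_norm_cart[of "x - y" i] by (simp add: dist_norm)

text \<open>
  The matrix of two uncoupled second order equations \<open>q\<^sub>1'' = a c q\<^sub>1\<close> and \<open>q\<^sub>2'' = b d q\<^sub>2\<close>,
  written as a first order system in \<open>(q\<^sub>1, q\<^sub>2, p\<^sub>1, p\<^sub>2)\<close>.
\<close>

lemma charpoly_second_order_diagonal:
  fixes K :: "real^4^4"
  assumes "K = vector [vector [0, 0, a, 0], vector [0, 0, 0, b], vector [c, 0, 0, 0], vector [0, d, 0, 0]]"
  shows "charpoly K = [:- (a * c), 0, 1:] * [:- (b * d), 0, 1:]"
proof -
  have f1234: "finite {2::4, 3, 4}" "1 \<notin> {2::4, 3, 4}" by auto
  have f234: "finite {3::4, 4}" "2 \<notin> {3::4, 4}" by auto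
  have f34: "finite {4::4}" "3 \<notin> {4::4}" by auto
  show ?thesis
    unfolding charpoly_def det_def UNIV_4 assms
    unfolding sum_over_permutations_insert[OF f1234]
    unfolding sum_over_permutations_insert[OF f234]
    unfolding sum_over_permutations_insert[OF f34]
    unfolding permutes_sing
    by (simp add: sign_swap_id permutation_swap_id sign_compose sign_id swap_id_eq vector_4
        permutation_compose)
qed

section \<open>The effective potential and its derivatives\<close>

text \<open>
  Twice the distance between \<open>m\<close> and either of the equal masses. Writing the fractional powers in
  \<open>U_eff\<close> as integer powers of \<open>rho\<close> lets one differentiation rule serve \<open>U\<close> and its gradient.
\<close>

definition rho :: "real \<Rightarrow> real \<Rightarrow> real" where
  "rho R z = sqrt (R^2 + 4 * z^2)"

lemma rho_pos: "R > 0 \<Longrightarrow> rho R z > 0"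
  unfolding rho_def by (simp add: add_pos_nonneg)

lemma rho_0: "R > 0 \<Longrightarrow> rho R 0 = R"
  by (simp add: rho_def)

lemma rho_ge: "R > 0 \<Longrightarrow> rho R z \<ge> R"
  unfolding rho_def by (rule real_le_rsqrt) simp

lemma rho_gt: "R > 0 \<Longrightarrow> z \<noteq> 0 \<Longrightarrow> rho R z > R"
  unfolding rho_def by (rule real_less_rsqrt) simp

lemma has_derivative_one_over_power:
  fixes f :: "'a::real_normed_vector \<Rightarrow> real"
  assumes f: "(f has_derivative f') (at x within S)" and pos: "f x > 0"
  shows "((\<lambda>x. 1 / f x ^ n) has_derivative (\<lambda>h. - real n * f' h / f x ^ (n + 1))) (at x within S)"
proof -
  have "((\<lambda>r. inverse (r ^ n)) has_real_derivative
      - (inverse (f x ^ n) * (real n * f x ^ (n - Suc 0)) * inverse (f x ^ n))) (at (f x))"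
    using pos by (intro DERIV_inverse' DERIV_pow) auto
  moreover have "inverse (f x ^ n) * (real n * f x ^ (n - Suc 0)) * inverse (f x ^ n)
      = real n / f x ^ (n + 1)"
    using pos by (cases n) (auto simp: field_simps)
  ultimately have "((\<lambda>r. 1 / r ^ n) has_real_derivative - real n / f x ^ (n + 1)) (at (f x))"
    by (simp add: inverse_eq_divide)
  from DERIV_compose_FDERIV[OF this f] show ?thesis by (simp add: mult.commute)
qed

lemma has_derivative_rho_power:
  assumes f: "(f has_derivative f') (at x within S)" and g: "(g has_derivative g') (at x within S)"
    and pos: "f x > 0"
  shows "((\<lambda>x. 1 / rho (f x) (g x) ^ n) has_derivative
    (\<lambda>h. - real n * (f x * f' h + 4 * g x * g' h) / rho (f x) (g x) ^ (n + 2))) (at x within S)"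
proof -
  have s: "(f x)\<^sup>2 + 4 * (g x)\<^sup>2 > 0" using pos by (simp add: add_pos_nonneg)
  have "((\<lambda>x. rho (f x) (g x)) has_derivative
      (\<lambda>h. (f x * f' h + 4 * g x * g' h) / rho (f x) (g x))) (at x within S)"
    unfolding rho_def using s f g
    by (auto intro!: derivative_eq_intros simp: field_simps)
  from has_derivative_one_over_power[OF this rho_pos[OF pos], of n] show ?thesis
    by (simp add: mult.assoc)
qed

lemma continuous_on_rho [continuous_intros]:
  "continuous_on S f \<Longrightarrow> continuous_on S g \<Longrightarrow> continuous_on S (\<lambda>x. rho (f x) (g x))"
  unfolding rho_def by (intro continuous_intros)

locale isosceles_schwarzschild =
  fixes M m A A1 B B1 C :: real
  assumes pos: "M > 0" "m > 0" "A > 0" "A1 > 0" "B > 0" "B1 > 0" "C > 0"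
begin

abbreviation "U \<equiv> U_eff M A B A1 B1 C"
abbreviation "X \<equiv> X_red M m A B A1 B1 C"

definition U_R :: "real \<Rightarrow> real \<Rightarrow> real" where
  "U_R R z = - 2 * C^2 / (M * R^3) + A / R^2 + 3 * B / R^4
     + 4 * A1 * R / rho R z ^ 3 + 48 * B1 * R / rho R z ^ 5"

definition U_z :: "real \<Rightarrow> real \<Rightarrow> real" where
  "U_z R z = 16 * A1 * z / rho R z ^ 3 + 192 * B1 * z / rho R z ^ 5"

definition U_RR :: "real \<Rightarrow> real \<Rightarrow> real" where
  "U_RR R z = 6 * C^2 / (M * R^4) - 2 * A / R^3 - 12 * B / R^5
     + 4 * A1 * (1 / rho R z ^ 3 - 3 * R^2 / rho R z ^ 5)
     + 48 * B1 * (1 / rho R z ^ 5 - 5 * R^2 / rho R z ^ 7)"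

definition U_Rz :: "real \<Rightarrow> real \<Rightarrow> real" where
  "U_Rz R z = - 48 * A1 * R * z / rho R z ^ 5 - 960 * B1 * R * z / rho R z ^ 7"

definition U_zz :: "real \<Rightarrow> real \<Rightarrow> real" where
  "U_zz R z = 16 * A1 * (1 / rho R z ^ 3 - 12 * z^2 / rho R z ^ 5)
     + 192 * B1 * (1 / rho R z ^ 5 - 20 * z^2 / rho R z ^ 7)"

text \<open>
  Every summand is brought to the form of \<open>has_derivative_one_over_power\<close> or
  \<open>has_derivative_rho_power\<close>; this is what the trivial exponents are for.
\<close>

lemma U_eq: "U R z = C^2 / M * (1 / R^2) - A * (1 / R^1) - B * (1 / R^3)
    - 4 * A1 * (1 / rho R z ^ 1) - 16 * B1 * (1 / rho R z ^ 3)"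
proof -
  have "(R^2 + 4 * z^2) powr (3/2) = ((R^2 + 4 * z^2) powr (1/2)) ^ 3"
    by (cases "R^2 + 4 * z^2 = 0") (simp_all add: powr_power)
  then show ?thesis
    by (simp add: U_eff_def rho_def powr_half_sqrt)
qed

text \<open>
  The derivatives are stated along arbitrary differentiable \<open>f\<close> and \<open>g\<close>, so that partial derivatives,
  derivatives along a motion and derivatives on phase space are all instances.
\<close>

context
  fixes f g :: "'a::real_normed_vector \<Rightarrow> real" and f' g' x S
  assumes f: "(f has_derivative f') (at x within S)" and g: "(g has_derivative g') (at x within S)"
    and f_pos: "f x > 0"
begin

lemma has_derivative_U:
  "((\<lambda>x. U (f x) (g x)) has_derivative
    (\<lambda>h. U_R (f x) (g x) * f' h + U_z (f x) (g x) * g' h)) (at x within S)"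
  unfolding U_eq U_R_def U_z_def
  by (rule derivative_eq_intros refl has_derivative_rho_power[OF f g f_pos]
        has_derivative_one_over_power[OF f f_pos])+
     (simp add: fun_eq_iff algebra_simps add_divide_distrib diff_divide_distrib eval_nat_numeral)

lemma has_derivative_U_R:
  "((\<lambda>x. U_R (f x) (g x)) has_derivative
    (\<lambda>h. U_RR (f x) (g x) * f' h + U_Rz (f x) (g x) * g' h)) (at x within S)"
proof -
  have eq: "U_R R z = - 2 * C^2 / M * (1 / R^3) + A * (1 / R^2) + 3 * B * (1 / R^4)
     + 4 * A1 * R * (1 / rho R z ^ 3) + 48 * B1 * R * (1 / rho R z ^ 5)" for R z
    by (simp add: U_R_def)
  show ?thesis
    unfolding eq U_RR_def U_Rz_def
    by (rule derivative_eq_intros refl f has_derivative_rho_power[OF f g f_pos]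
          has_derivative_one_over_power[OF f f_pos])+
       (simp add: fun_eq_iff algebra_simps add_divide_distrib diff_divide_distrib eval_nat_numeral)
qed

lemma has_derivative_U_z:
  "((\<lambda>x. U_z (f x) (g x)) has_derivative
    (\<lambda>h. U_Rz (f x) (g x) * f' h + U_zz (f x) (g x) * g' h)) (at x within S)"
proof -
  have eq: "U_z R z = 16 * A1 * z * (1 / rho R z ^ 3) + 192 * B1 * z * (1 / rho R z ^ 5)" for R z
    by (simp add: U_z_def)
  show ?thesis
    unfolding eq U_zz_def U_Rz_def
    by (rule derivative_eq_intros refl g has_derivative_rho_power[OF f g f_pos])+
       (simp add: fun_eq_iff algebra_simps add_divide_distrib diff_divide_distrib eval_nat_numeral)
qed

end

lemma DERIV_U_R: "R > 0 \<Longrightarrow> ((\<lambda>q. U q z) has_real_derivative U_R R z) (at R)"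
  using has_derivative_U[of "\<lambda>q. q" "\<lambda>q. q" R UNIV "\<lambda>q. z" "\<lambda>q. 0"]
  by (simp add: has_field_derivative_def)

lemma DERIV_U_z: "R > 0 \<Longrightarrow> ((\<lambda>q. U R q) has_real_derivative U_z R z) (at z)"
  using has_derivative_U[of "\<lambda>q. R" "\<lambda>q. 0" z UNIV "\<lambda>q. q" "\<lambda>q. q"]
  by (simp add: has_field_derivative_def)

section \<open>The reduced vector field\<close>

text \<open>The factor in \<open>z' = \<kappa> P\<^sub>z\<close>.\<close>

abbreviation "\<kappa> \<equiv> (2 * M + m) / (2 * M * m)"

lemma X_eq:
  assumes "x \<in> phase_space"
  shows "X x = vector [2 / M * x $ 3, \<kappa> * x $ 4, - U_R (x $ 1) (x $ 2), - U_z (x $ 1) (x $ 2)]"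
proof -
  have R: "x $ 1 > 0" using assms by (simp add: phase_space_def)
  show ?thesis
    using DERIV_imp_deriv[OF DERIV_U_R[OF R]] DERIV_imp_deriv[OF DERIV_U_z[OF R]]
    by (simp add: hamiltonian_vf_H_red pos)
qed

definition DX :: "real^4 \<Rightarrow> real^4^4" where
  "DX x = vector
    [vector [0, 0, 2 / M, 0],
     vector [0, 0, 0, \<kappa>],
     vector [- U_RR (x $ 1) (x $ 2), - U_Rz (x $ 1) (x $ 2), 0, 0],
     vector [- U_Rz (x $ 1) (x $ 2), - U_zz (x $ 1) (x $ 2), 0, 0]]"

lemma open_phase_space: "open phase_space"
  unfolding phase_space_def by (intro open_Collect_less continuous_intros)

lemma has_derivative_X:
  assumes "x \<in> phase_space"
  shows "(X has_derivative (\<lambda>h. DX x *v h)) (at x)"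
proof (rule has_derivative_transform_within_open[OF _ open_phase_space assms])
  have R: "x $ 1 > 0" using assms by (simp add: phase_space_def)
  have nth: "((\<lambda>y. y $ i) has_derivative (\<lambda>h. h $ i)) (at x)" for i :: 4
    by (intro bounded_linear_imp_has_derivative bounded_linear_vec_nth)
  let ?Y = "\<lambda>y. vector [2 / M * y $ 3, \<kappa> * y $ 4, - U_R (y $ 1) (y $ 2), - U_z (y $ 1) (y $ 2)] :: real^4"
  have DX_mult: "DX x *v h = vector [2 / M * h $ 3, \<kappa> * h $ 4,
      - (U_RR (x $ 1) (x $ 2) * h $ 1 + U_Rz (x $ 1) (x $ 2) * h $ 2),
      - (U_Rz (x $ 1) (x $ 2) * h $ 1 + U_zz (x $ 1) (x $ 2) * h $ 2)]" for h
    by (simp add: vec_eq_iff forall_4 vector_4 DX_def matrix_vector_mult_def sum_4)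
  have "((\<lambda>y. ?Y y $ i) has_derivative (\<lambda>h. (DX x *v h) $ i)) (at x)" for i
  proof -
    consider "i = 1" | "i = 2" | "i = 3" | "i = 4" using exhaust_4 by blast
    then show ?thesis
      unfolding DX_mult
      by cases (simp_all only: vector_4 has_derivative_mult_right has_derivative_minus nth
          has_derivative_U_R[OF nth nth R] has_derivative_U_z[OF nth nth R])
  qed
  then show "(?Y has_derivative (\<lambda>h. DX x *v h)) (at x)"
    by (subst has_derivative_componentwise_within)
       (auto simp: Basis_vec_def inner_axis)
qed (simp add: X_eq)


text \<open>
  The entries of the derivative are continuous, hence bounded on a compact set, and the mean value
  inequality needs convexity.
\<close>

lemma lipschitz_X:
  assumes K: "compact K" "convex K" "K \<subseteq> phase_space"
  obtains L where "L-lipschitz_on K X"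
proof -
  have R: "x $ 1 > 0" if "x \<in> K" for x using that K by (auto simp: phase_space_def)
  have rho: "rho (x $ 1) (x $ 2) \<noteq> 0" if "x \<in> K" for x using rho_pos[OF R[OF that], of "x $ 2"] by simp
  have bdd: "\<exists>b. \<forall>x\<in>K. \<bar>f x\<bar> \<le> b" if "continuous_on K f" for f :: "real^4 \<Rightarrow> real"
    using compact_imp_bounded[OF compact_continuous_image[OF that K(1)]]
    by (auto simp: bounded_iff)
  have ne: "\<forall>x\<in>K. x $ 1 \<noteq> 0" "\<forall>x\<in>K. rho (x $ 1) (x $ 2) \<noteq> 0" "M \<noteq> 0"
    using R rho pos by force+
  have "continuous_on K (\<lambda>x. U_RR (x $ 1) (x $ 2))" "continuous_on K (\<lambda>x. U_Rz (x $ 1) (x $ 2))"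
      "continuous_on K (\<lambda>x. U_zz (x $ 1) (x $ 2))"
    unfolding U_RR_def U_Rz_def U_zz_def by (intro continuous_intros; use ne in simp)+
  then have "\<forall>i j. continuous_on K (\<lambda>x. DX x $ i $ j)"
    unfolding forall_4 DX_def vector_4
    by (intro conjI continuous_on_minus continuous_on_const)
  then have "\<exists>b. \<forall>x\<in>K. \<bar>DX x $ i $ j\<bar> \<le> b" for i j
    by (intro bdd) blast
  then obtain b where b: "\<And>i j x. x \<in> K \<Longrightarrow> \<bar>DX x $ i $ j\<bar> \<le> b i j" by metis
  define c where "c = (\<Sum>i\<in>UNIV. \<Sum>j\<in>UNIV. b i j)"
  have onorm: "onorm ((*v) (DX x)) \<le> c" if "x \<in> K" for x
    using onorm_le_matrix_component_sum[of "DX x"] sum_mono[OF sum_mono[OF b[OF that]]]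
    by (force simp: c_def intro: order_trans)
  show ?thesis
  proof (rule that, rule lipschitz_onI)
    fix x y assume xy: "x \<in> K" "y \<in> K"
    have "norm (X x - X y) \<le> c * norm (x - y)"
      using K(2) has_derivative_at_withinI[OF has_derivative_X] K(3) onorm xy
      by (intro differentiable_bound[where S = K and f' = "\<lambda>x. (*v) (DX x)"]) auto
    also have "\<dots> \<le> \<bar>c\<bar> * norm (x - y)" by (intro mult_right_mono) auto
    finally show "dist (X x) (X y) \<le> \<bar>c\<bar> * dist x y" by (simp add: dist_norm)
  qed simp
qed

lemma charpoly_DX_rest_point:
  assumes "R > 0"
  shows "charpoly (DX (rest_point R 0)) = [:2 / M * U_RR R 0, 0, 1:] * [:\<kappa> * U_zz R 0, 0, 1:]"
proof -
  have "DX (rest_point R 0) = vector [vector [0, 0, 2 / M, 0], vector [0, 0, 0, \<kappa>],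
      vector [- U_RR R 0, 0, 0, 0], vector [0, - U_zz R 0, 0, 0]]"
    by (simp add: DX_def rest_point_def vector_4 U_Rz_def)
  from charpoly_second_order_diagonal[OF this] show ?thesis by simp
qed

definition energy :: "real^4 \<Rightarrow> real" where
  "energy x = H_red M m A B A1 B1 C (x $ 1) (x $ 2) (x $ 3) (x $ 4)"

lemma energy_eq: "energy x = (x $ 3)^2 / M + \<kappa> / 2 * (x $ 4)^2 + U (x $ 1) (x $ 2)"
  by (simp add: energy_def H_red_def field_simps)

text \<open>
  Along a motion the force terms \<open>U_R R' + U_z z'\<close> cancel against the change of kinetic energy.
\<close>

lemma energy_conserved:
  assumes T: "T \<ge> 0" and sol: "solution_on phase_space X {0..T} \<gamma>"
  shows "energy (\<gamma> T) = energy (\<gamma> 0)"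
proof -
  have "((\<lambda>t. energy (\<gamma> t)) has_real_derivative 0) (at t within {0..T})" if t: "t \<in> {0..T}" for t
  proof -
    have "\<gamma> t \<in> phase_space" and vd: "(\<gamma> has_vector_derivative X (\<gamma> t)) (at t within {0..T})"
      using sol t by (auto simp: solution_on_def)
    then have R: "\<gamma> t $ 1 > 0" by (simp add: phase_space_def)
    have d: "((\<lambda>t. \<gamma> t $ i) has_real_derivative X (\<gamma> t) $ i) (at t within {0..T})" for i
      using bounded_linear.has_vector_derivative[OF bounded_linear_vec_nth vd]
      by (simp add: has_real_derivative_iff_has_vector_derivative)
    note X = X_eq[OF \<open>\<gamma> t \<in> phase_space\<close>]
    have "((\<lambda>t. U (\<gamma> t $ 1) (\<gamma> t $ 2)) has_real_derivative
        U_R (\<gamma> t $ 1) (\<gamma> t $ 2) * X (\<gamma> t) $ 1 + U_z (\<gamma> t $ 1) (\<gamma> t $ 2) * X (\<gamma> t) $ 2)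
        (at t within {0..T})"
      using has_derivative_U[OF d[of 1, unfolded has_field_derivative_def]
          d[of 2, unfolded has_field_derivative_def] R]
      unfolding has_field_derivative_def
      by (rule has_derivative_eq_rhs) (simp add: fun_eq_iff algebra_simps)
    then have "((\<lambda>t. energy (\<gamma> t)) has_real_derivative
        2 * (\<gamma> t $ 3) * X (\<gamma> t) $ 3 / M + \<kappa> / 2 * (2 * (\<gamma> t $ 4) * X (\<gamma> t) $ 4)
        + (U_R (\<gamma> t $ 1) (\<gamma> t $ 2) * X (\<gamma> t) $ 1 + U_z (\<gamma> t $ 1) (\<gamma> t $ 2) * X (\<gamma> t) $ 2))
        (at t within {0..T})"
      unfolding energy_eq
      by (intro DERIV_add DERIV_cmult DERIV_cdivide) (auto intro!: derivative_eq_intros d)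
    moreover have "2 * (\<gamma> t $ 3) * X (\<gamma> t) $ 3 / M + \<kappa> / 2 * (2 * (\<gamma> t $ 4) * X (\<gamma> t) $ 4)
        + (U_R (\<gamma> t $ 1) (\<gamma> t $ 2) * X (\<gamma> t) $ 1 + U_z (\<gamma> t $ 1) (\<gamma> t $ 2) * X (\<gamma> t) $ 2) = 0"
      unfolding X vector_4 by simp
    ultimately show ?thesis by simp
  qed
  then show ?thesis
    using has_field_derivative_zero_constant[of "{0..T}" "\<lambda>t. energy (\<gamma> t)"] T
    by (metis atLeastAtMost_iff convex_real_interval(5) order_refl)
qed

section \<open>Relative equilibria\<close>

definition "\<alpha> = M * (A + 4 * A1)"
definition "\<beta> = M * (B + 16 * B1)"

lemma \<alpha>_pos: "\<alpha> > 0" and \<beta>_pos: "\<beta> > 0"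
  using pos by (auto simp: \<alpha>_def \<beta>_def add_pos_pos)

text \<open>
  The numerator is \<open>\<alpha>\<close> times the quadratic \<open>\<alpha> R\<^sup>2 - 2 C\<^sup>2 R + 3 \<beta>\<close>, with the square completed.
\<close>

lemma U_R_collinear:
  assumes "R > 0"
  shows "U_R R 0 = ((\<alpha> * R - C^2)^2 - (C^4 - 3 * \<alpha> * \<beta>)) / (\<alpha> * M * R^4)"
proof -
  have "U_R R 0 = (\<alpha> * R^2 - 2 * C^2 * R + 3 * \<beta>) / (M * R^4)"
    using assms pos
    by (simp add: U_R_def rho_0 \<alpha>_def \<beta>_def field_simps eval_nat_numeral)
  also have "\<dots> = (\<alpha> * (\<alpha> * R^2 - 2 * C^2 * R + 3 * \<beta>)) / (\<alpha> * (M * R^4))"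
    using \<alpha>_pos by simp
  also have "\<alpha> * (\<alpha> * R^2 - 2 * C^2 * R + 3 * \<beta>) = (\<alpha> * R - C^2)^2 - (C^4 - 3 * \<alpha> * \<beta>)"
    by (simp add: algebra_simps eval_nat_numeral)
  finally show ?thesis by (simp add: ac_simps)
qed

lemma U_z_eq_0_iff:
  assumes "R > 0"
  shows "U_z R z = 0 \<longleftrightarrow> z = 0"
proof -
  have "U_z R z = z * (16 * A1 / rho R z ^ 3 + 192 * B1 / rho R z ^ 5)"
    by (simp add: U_z_def algebra_simps)
  moreover have "16 * A1 / rho R z ^ 3 + 192 * B1 / rho R z ^ 5 > 0"
    using pos rho_pos[OF assms] by (intro add_pos_pos) auto
  ultimately show ?thesis by simp
qed

lemma relative_equilibria_eq:
  "relative_equilibria M m A B A1 B1 C =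
     {rest_point R 0 | R. R > 0 \<and> (\<alpha> * R - C^2)^2 = C^4 - 3 * \<alpha> * \<beta>}"
proof -
  have "x \<in> relative_equilibria M m A B A1 B1 C \<longleftrightarrow>
      x $ 1 > 0 \<and> x $ 3 = 0 \<and> x $ 4 = 0 \<and> x $ 2 = 0 \<and> (\<alpha> * x $ 1 - C^2)^2 = C^4 - 3 * \<alpha> * \<beta>" for x
  proof (cases "x $ 1 > 0")
    case R: True
    show ?thesis
      using U_R_collinear[OF R] \<alpha>_pos pos R
      by (auto simp: mem_relative_equilibria_iff[OF pos(1,2)] DERIV_imp_deriv[OF DERIV_U_R[OF R]]
          DERIV_imp_deriv[OF DERIV_U_z[OF R]] U_z_eq_0_iff)
  qed (simp add: mem_relative_equilibria_iff[OF pos(1,2)])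
  moreover have "x = rest_point R 0 \<longleftrightarrow> x $ 1 = R \<and> x $ 2 = 0 \<and> x $ 3 = 0 \<and> x $ 4 = 0" for x R
    by (auto simp: rest_point_def vec_eq_iff forall_4 vector_4)
  ultimately show ?thesis by auto
qed

text \<open>
  Here \<open>R\<close> is the double root of the quadratic in the numerator of \<open>U_R R 0\<close>, so \<open>U_RR R 0\<close> vanishes,
  while \<open>U_zz R 0\<close> is positive. The characteristic polynomial is thus \<open>\<lambda>\<^sup>2 (\<lambda>\<^sup>2 + \<kappa> U_zz)\<close>.
\<close>

lemma degenerate_linearization:
  assumes C: "C^4 = 3 * \<alpha> * \<beta>" and R: "R = C^2 / \<alpha>"
  shows "X differentiable (at (rest_point R 0))"
    and "linearization_multiplicity X (rest_point R 0) 0 = 2"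
proof -
  have R_pos: "R > 0" using R \<alpha>_pos pos by simp
  have "rest_point R 0 \<in> phase_space" using R_pos by (simp add: phase_space_def rest_point_nth)
  note D = has_derivative_X[OF this]
  then show "X differentiable (at (rest_point R 0))" by (rule differentiableI)
  have jac: "jacobian X (at (rest_point R 0)) = DX (rest_point R 0)"
    unfolding jacobian_def frechet_derivative_at[OF D, symmetric] by simp
  have "U_RR R 0 = (6 * C^2 * R - 2 * \<alpha> * R^2 - 12 * \<beta>) / (M * R^5)"
    using R_pos pos by (simp add: U_RR_def rho_0 \<alpha>_def \<beta>_def field_simps eval_nat_numeral)
  also have "6 * C^2 * R - 2 * \<alpha> * R^2 - 12 * \<beta> = 0"
  proof -
    have "\<alpha> * (6 * C^2 * R - 2 * \<alpha> * R^2 - 12 * \<beta>) = 6 * C^2 * (\<alpha> * R) - 2 * (\<alpha> * R)^2 - 4 * (3 * \<alpha> * \<beta>)"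
      by (simp add: algebra_simps power2_eq_square)
    also have "\<dots> = 0" using \<alpha>_pos by (simp add: R C[symmetric] eval_nat_numeral)
    finally show ?thesis using \<alpha>_pos by simp
  qed
  finally have RR: "U_RR R 0 = 0" by simp
  have "U_zz R 0 > 0"
    using pos R_pos by (simp add: U_zz_def rho_0 add_pos_pos)
  moreover have "\<kappa> > 0" using pos by simp
  ultimately have k: "\<kappa> * U_zz R 0 > 0" by (intro mult_pos_pos)
  define q where "q = [:\<kappa> * U_zz R 0, 0, 1:]"
  have q: "q \<noteq> 0" "order 0 q = 0" using k by (auto simp: q_def intro!: order_0I)
  have "charpoly (jacobian X (at (rest_point R 0))) = [:- 0, 1:] ^ 2 * q"
    unfolding jac charpoly_DX_rest_point[OF R_pos] q_def[symmetric]
    by (simp add: RR power2_eq_square)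
  moreover have "order 0 ([:- 0, 1:] ^ 2 * q) = order (0::real) ([:- 0, 1:] ^ 2) + order 0 q"
    using q by (intro order_mult) simp
  ultimately show "linearization_multiplicity X (rest_point R 0) 0 = 2"
    unfolding linearization_multiplicity_def by (simp only: order_power_n_n q)
qed

section \<open>Stability and instability\<close>

text \<open>
  Moving \<open>m\<close> off the plane increases its distance to the equal masses, and both of its interactions
  are attractive.
\<close>

lemma U_collinear_less:
  assumes R: "R > 0" and z: "z \<noteq> 0"
  shows "U R 0 < U R z"
proof -
  have "c * (1 / rho R z ^ n) < c * (1 / R ^ n)" if "n > 0" "c > 0" for c n
    using rho_gt[OF R z] R that
    by (intro mult_strict_left_mono divide_strict_left_mono power_strict_mono mult_pos_pos) auto
  from this[of 1 "4 * A1"] this[of 3 "16 * B1"] show ?thesis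
    unfolding U_eq rho_0[OF R] using pos by linarith
qed

lemma U_collinear_le: "R > 0 \<Longrightarrow> U R 0 \<le> U R z"
  using U_collinear_less[of R z] by (cases "z = 0") auto

text \<open>
  Moving \<open>m\<close> off the plane weakens the part of the radial pull that \<open>m\<close> causes, because in
  \<open>4 A1 R / rho\<^sup>3\<close> and \<open>48 B1 R / rho\<^sup>5\<close> only \<open>rho\<close> depends on \<open>z\<close>.
  This lets the instability argument ignore the vertical motion.
\<close>

lemma U_R_le_collinear:
  assumes R: "R > 0" shows "U_R R z \<le> U_R R 0"
proof -
  have "c / rho R z ^ n \<le> c / R ^ n" if "c > 0" for c n
    using rho_ge[OF R, of z] R that by (intro divide_left_mono power_mono mult_pos_pos zero_less_power) auto
  from this[of "4 * A1 * R" 3] this[of "48 * B1 * R" 5] show ?thesis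
    using pos R unfolding U_R_def rho_0[OF R] by simp
qed

lemma U_collinear_decreasing:
  assumes "0 < a" "a < b" "\<And>q. a < q \<Longrightarrow> q < b \<Longrightarrow> U_R q 0 < 0"
  shows "U b 0 < U a 0"
proof (rule DERIV_neg_imp_decreasing_open[OF assms(2)])
  show "\<exists>y. ((\<lambda>q. U q 0) has_real_derivative y) (at q) \<and> y < 0" if "a < q" "q < b" for q
    using DERIV_U_R[of q 0] assms that by (metis less_trans)
  show "continuous_on {a..b} (\<lambda>q. U q 0)"
    using assms(1) by (intro continuous_at_imp_continuous_on ballI DERIV_isCont[OF DERIV_U_R]) auto
qed

lemma U_collinear_increasing:
  assumes "0 < a" "a < b" "\<And>q. a < q \<Longrightarrow> q < b \<Longrightarrow> U_R q 0 > 0"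
  shows "U a 0 < U b 0"
proof (rule DERIV_pos_imp_increasing_open[OF assms(2)])
  show "\<exists>y. ((\<lambda>q. U q 0) has_real_derivative y) (at q) \<and> y > 0" if "a < q" "q < b" for q
    using DERIV_U_R[of q 0] assms that by (metis less_trans)
  show "continuous_on {a..b} (\<lambda>q. U q 0)"
    using assms(1) by (intro continuous_at_imp_continuous_on ballI DERIV_isCont[OF DERIV_U_R]) auto
qed

lemma energy_ge: "energy x \<ge> U (x $ 1) (x $ 2)"
  using pos by (simp add: energy_eq)

text \<open>
  If the collinear potential has a strict local minimum at \<open>R1\<close>, then \<open>energy\<close> has one at the rest
  point: its value is at least \<open>U (x $ 1) 0\<close>, with a strict excess from \<open>z \<noteq> 0\<close> or from a nonzero
  momentum.
\<close>

lemma lyapunov_stable_rest_point: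
  assumes r: "r > 0" "r < R1"
    and decr: "\<And>R. R1 - r < R \<Longrightarrow> R < R1 \<Longrightarrow> U_R R 0 < 0"
    and incr: "\<And>R. R1 < R \<Longrightarrow> U_R R 0 > 0"
  shows "lyapunov_stable phase_space X (rest_point R1 0)"
proof -
  let ?p = "rest_point R1 0"
  have near: "\<bar>x $ 1 - R1\<bar> \<le> r" if "x \<in> cball ?p r" for x
    using abs_nth_diff_le_dist[of x 1 ?p] that by (simp add: rest_point_nth dist_commute)
  have R: "x $ 1 > 0" if "x \<in> cball ?p r" for x
    using near[OF that] r by linarith
  then have sub: "cball ?p r \<subseteq> phase_space" by (auto simp: phase_space_def)
  obtain L where L: "L-lipschitz_on (cball ?p r) X"
    using lipschitz_X[OF compact_cball convex_cball sub] .
  show ?thesis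
  proof (rule lyapunov_stable_strict_minimum_of_conserved[OF r(1) sub L _ _ energy_conserved])
    have "rho (x $ 1) (x $ 2) \<noteq> 0" if "x \<in> cball ?p r" for x
      using rho_pos[OF R[OF that], of "x $ 2"] by simp
    moreover have "x $ 1 \<noteq> 0" if "x \<in> cball ?p r" for x
      using R[OF that] by simp
    ultimately show "continuous_on (cball ?p r) energy"
      unfolding energy_eq[abs_def] U_eq
      using pos by (intro continuous_intros ballI) simp_all
  next
    fix x assume x: "x \<in> cball ?p r" "x \<noteq> ?p"
    have min: "U R1 0 < U (x $ 1) 0" if "x $ 1 \<noteq> R1"
    proof (cases "x $ 1 < R1")
      case True
      then show ?thesis
        using R[OF x(1)] near[OF x(1)] by (intro U_collinear_decreasing decr) auto
    next
      case False
      then show ?thesis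
        using r that by (intro U_collinear_increasing incr) auto
    qed
    have p: "energy ?p = U R1 0" by (simp add: energy_eq rest_point_nth)
    consider "x $ 1 \<noteq> R1" | "x $ 1 = R1" "x $ 2 \<noteq> 0" | "x $ 1 = R1" "x $ 2 = 0" "x $ 3 \<noteq> 0 \<or> x $ 4 \<noteq> 0"
      using x(2) by (auto simp: rest_point_def vec_eq_iff forall_4 vector_4)
    then show "energy ?p < energy x"
    proof cases
      case 1
      then show ?thesis
        using p min U_collinear_le[OF R[OF x(1)], of "x $ 2"] energy_ge[of x] by linarith
    next
      case 2
      then show ?thesis
        using p U_collinear_less[OF R[OF x(1)], of "x $ 2"] energy_ge[of x] by simp
    next
      case 3
      have "\<kappa> / 2 > 0" using pos by simp
      then have "(x $ 3)^2 / M + \<kappa> / 2 * (x $ 4)^2 > 0"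
        using 3(3) pos(1) zero_less_power2[of "x $ 3"] zero_less_power2[of "x $ 4"]
        by (metis add_nonneg_pos add_pos_nonneg divide_nonneg_pos divide_pos_pos mult_nonneg_nonneg
            mult_pos_pos less_imp_le zero_le_power2)
      then show ?thesis using p 3 by (simp add: energy_eq)
    qed
  qed
qed

text \<open>
  A motion released at rest slightly outside \<open>R2\<close>, on the descending side of the collinear potential,
  cannot climb back past its starting radius. If it stayed near the rest point, its radius
  would stay in \<open>[R2 + s, R2 + r]\<close>, where the outward force is bounded below, so \<open>P\<^sub>R\<close>
  would grow beyond \<open>r\<close>.
\<close>

lemma not_lyapunov_stable_rest_point:
  assumes r: "r > 0" "R2 > 0"
    and decr: "\<And>R. R2 < R \<Longrightarrow> R \<le> R2 + r \<Longrightarrow> U_R R 0 < 0"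
  shows "\<not> lyapunov_stable phase_space X (rest_point R2 0)"
proof
  let ?p = "rest_point R2 0"
  assume "lyapunov_stable phase_space X ?p"
  with r obtain \<delta> where \<delta>: "\<delta> > 0" and stable: "\<And>x. x \<in> phase_space \<Longrightarrow> dist x ?p < \<delta> \<Longrightarrow>
        (\<exists>\<gamma>. solution_on phase_space X {0..} \<gamma> \<and> \<gamma> 0 = x) \<and>
        (\<forall>T\<ge>0. \<forall>\<gamma>. solution_on phase_space X {0..T} \<gamma> \<and> \<gamma> 0 = x \<longrightarrow>
           (\<forall>t\<in>{0..T}. dist (\<gamma> t) ?p < r))"
    unfolding lyapunov_stable_def by metis
  define s where "s = min (\<delta> / 2) (r / 2)"
  have s: "s > 0" "s < \<delta>" "s < r" using \<delta> r by (auto simp: s_def)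
  define x where "x = rest_point (R2 + s) 0"
  have "dist x ?p = s"
  proof -
    have "x - ?p = axis 1 s"
      by (simp add: x_def vec_eq_iff forall_4 rest_point_nth axis_def)
    then show ?thesis using s by (simp add: dist_norm norm_eq_sqrt_inner inner_axis_axis)
  qed
  moreover have "x \<in> phase_space" using r s by (simp add: x_def phase_space_def rest_point_nth)
  ultimately obtain \<gamma> where sol: "solution_on phase_space X {0..} \<gamma>" and \<gamma>0: "\<gamma> 0 = x"
    and near: "\<And>T \<gamma>. T \<ge> 0 \<Longrightarrow> solution_on phase_space X {0..T} \<gamma> \<Longrightarrow> \<gamma> 0 = x \<Longrightarrow> dist (\<gamma> T) ?p < r"
    using stable[of x] s by auto
  have sol_T: "solution_on phase_space X {0..T} \<gamma>" for T
    using sol unfolding solution_on_def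
    by (auto intro: has_vector_derivative_within_subset[where S = "{0..}"])
  have close: "\<bar>\<gamma> t $ i - ?p $ i\<bar> < r" if "t \<ge> 0" for t i
    using abs_nth_diff_le_dist[of "\<gamma> t" i ?p] near[OF that sol_T \<gamma>0] by linarith
  have in_S: "\<gamma> t \<in> phase_space" if "t \<ge> 0" for t
    using sol that by (simp add: solution_on_def)
  have R_pos: "\<gamma> t $ 1 > 0" if "t \<ge> 0" for t
    using in_S[OF that] by (simp add: phase_space_def)
  have deriv: "((\<lambda>t. \<gamma> t $ i) has_vector_derivative X (\<gamma> t) $ i) (at t within {0..T})"
    if "t \<in> {0..T}" for t T i
    using sol_T[of T] that
    by (auto simp: solution_on_def intro!: bounded_linear.has_vector_derivative[OF bounded_linear_vec_nth])
  have energy_le: "U (\<gamma> t $ 1) 0 \<le> U (R2 + s) 0" if "t \<ge> 0" for t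
  proof -
    have "energy (\<gamma> t) = energy x"
      using energy_conserved[OF that sol_T] \<gamma>0 by simp
    also have "\<dots> = U (R2 + s) 0" by (simp add: energy_eq x_def rest_point_nth)
    finally show ?thesis
      using energy_ge[of "\<gamma> t"] U_collinear_le[OF R_pos[OF that], of "\<gamma> t $ 2"] by linarith
  qed
  \<comment> \<open>the collinear potential at these radii exceeds the total energy; on crossing inwards the
    radius would have to take such a value, namely \<open>R2\<close> at the latest\<close>
  have not_between: "\<not> (R2 \<le> \<gamma> t $ 1 \<and> \<gamma> t $ 1 < R2 + s)" if "t \<ge> 0" for t
  proof
    assume between: "R2 \<le> \<gamma> t $ 1 \<and> \<gamma> t $ 1 < R2 + s"
    have "U (R2 + s) 0 < U (\<gamma> t $ 1) 0"
      using between s R_pos[OF that] by (intro U_collinear_decreasing decr) auto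
    with energy_le[OF that] show False by simp
  qed
  have R_ge: "R2 + s \<le> \<gamma> t $ 1" if "t \<ge> 0" for t
  proof (rule ccontr)
    assume "\<not> R2 + s \<le> \<gamma> t $ 1"
    then have "\<gamma> t $ 1 \<le> R2" using not_between[OF that] by auto
    moreover have "R2 \<le> \<gamma> 0 $ 1" using s by (simp add: \<gamma>0 x_def rest_point_nth)
    moreover have "continuous_on {0..t} (\<lambda>u. \<gamma> u $ 1)"
      by (rule continuous_on_vector_derivative[where f' = "\<lambda>u. X (\<gamma> u) $ 1"]) (rule deriv)
    ultimately obtain u where "0 \<le> u" "\<gamma> u $ 1 = R2"
      using IVT2'[of "\<lambda>u. \<gamma> u $ 1" t R2 0] \<open>t \<ge> 0\<close> by auto
    then show False using not_between[of u] s by simp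
  qed
  obtain c where c: "c > 0" "\<And>R. R \<in> {R2 + s..R2 + r} \<Longrightarrow> U_R R 0 \<le> - c"
  proof -
    have "continuous_on {R2 + s..R2 + r} (\<lambda>R. U_R R 0)"
    proof (intro continuous_at_imp_continuous_on ballI)
      fix R assume "R \<in> {R2 + s..R2 + r}"
      then have "R > 0" using r s by simp
      from has_derivative_U_R[OF has_derivative_ident has_derivative_const this]
      show "isCont (\<lambda>R. U_R R 0) R" by (rule has_derivative_continuous)
    qed
    moreover have "{R2 + s..R2 + r} \<noteq> {}" using s by simp
    ultimately obtain a where a: "a \<in> {R2 + s..R2 + r}"
      and max: "\<And>R. R \<in> {R2 + s..R2 + r} \<Longrightarrow> U_R R 0 \<le> U_R a 0"
      using continuous_attains_sup[OF compact_Icc] by metis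
    have "U_R a 0 < 0" using a s by (intro decr) auto
    with max show ?thesis using that[of "- U_R a 0"] by simp
  qed
  \<comment> \<open>by \<open>U_R_le_collinear\<close> the bound on the collinear force holds for every height\<close>
  have push: "X (\<gamma> t) $ 3 \<ge> c" if "t \<ge> 0" for t
  proof -
    have "\<gamma> t $ 1 \<in> {R2 + s..R2 + r}"
      using R_ge[OF that] close[OF that, of 1] by (auto simp: rest_point_nth)
    then show ?thesis
      using U_R_le_collinear[OF R_pos[OF that], of "\<gamma> t $ 2"] c(2)[of "\<gamma> t $ 1"]
      unfolding X_eq[OF in_S[OF that]] vector_4 by linarith
  qed
  have "0 < r / c" using r c by simp
  then obtain u where "u \<in> {0<..<r / c}" and "\<gamma> (r / c) $ 3 - \<gamma> 0 $ 3 = (r / c - 0) * (X (\<gamma> u) $ 3)"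
    using mvt_simple[of 0 "r / c" "\<lambda>t. \<gamma> t $ 3" "\<lambda>t h. h * X (\<gamma> t) $ 3"] deriv
    by (auto simp: has_vector_derivative_def)
  moreover have "\<gamma> 0 $ 3 = 0" by (simp add: \<gamma>0 x_def rest_point_nth)
  moreover have "r / c * c \<le> r / c * (X (\<gamma> u) $ 3)"
    using \<open>0 < r / c\<close> \<open>u \<in> {0<..<r / c}\<close> by (intro mult_left_mono push) auto
  ultimately have "\<gamma> (r / c) $ 3 \<ge> r / c * c" by simp
  then have "\<gamma> (r / c) $ 3 \<ge> r" using c by simp
  then show False using close[of "r / c" 3] \<open>0 < r / c\<close> by (simp add: rest_point_nth)
qed

end

theorem proposition1:
  fixes M m A A1 B B1 C \<alpha> \<beta> C0 R0 R1 R2 :: real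
  assumes "M > 0" "m > 0" "A > 0" "A1 > 0" "B > 0" "B1 > 0" "C > 0"
    and "\<alpha> = M * (A + 4 * A1)"
    and "\<beta> = M * (B + 16 * B1)"
    and "C0 = root 4 (3 * \<alpha> * \<beta>)"
    and "R0 = C^2 / \<alpha>"
    and "R1 = (C^2 + sqrt (C^4 - C0^4)) / \<alpha>"
    and "R2 = (C^2 - sqrt (C^4 - C0^4)) / \<alpha>"
  shows "(C < C0 \<longrightarrow> relative_equilibria M m A B A1 B1 C = {}) \<and>
         (C = C0 \<longrightarrow>
           relative_equilibria M m A B A1 B1 C = {rest_point R0 0} \<and>
           X_red M m A B A1 B1 C differentiable (at (rest_point R0 0)) \<and>
           linearization_multiplicity (X_red M m A B A1 B1 C) (rest_point R0 0) 0 = 2) \<and>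
         (C > C0 \<longrightarrow>
           relative_equilibria M m A B A1 B1 C = {rest_point R1 0, rest_point R2 0} \<and>
           rest_point R1 0 \<noteq> rest_point R2 0 \<and>
           lyapunov_stable phase_space (X_red M m A B A1 B1 C) (rest_point R1 0) \<and>
           \<not> lyapunov_stable phase_space (X_red M m A B A1 B1 C) (rest_point R2 0))"
proof -
  interpret S: isosceles_schwarzschild M m A A1 B B1 C
    by standard (use assms in simp_all)
  have [simp]: "S.\<alpha> = \<alpha>" "S.\<beta> = \<beta>" by (simp_all add: S.\<alpha>_def S.\<beta>_def assms)
  have \<alpha>: "\<alpha> > 0" and \<beta>: "\<beta> > 0" using S.\<alpha>_pos S.\<beta>_pos by simp_all
  have C0: "C0 > 0" "C0^4 = 3 * \<alpha> * \<beta>"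
    using \<alpha> \<beta> by (simp_all add: assms(10))
  note rel_eq = S.relative_equilibria_eq[simplified, folded C0(2)]
  show ?thesis
  proof (intro conjI impI)
    assume "C < C0"
    then have "C^4 < C0^4" using assms by (intro power_strict_mono) auto
    then have "(\<alpha> * R - C^2)^2 \<noteq> C^4 - C0^4" for R
      using zero_le_power2[of "\<alpha> * R - C^2"] by linarith
    then show "relative_equilibria M m A B A1 B1 C = {}" unfolding rel_eq by simp
  next
    assume C: "C = C0"
    have "R0 > 0" using \<alpha> assms(7) by (simp add: assms(11))
    moreover have "(\<alpha> * R - C^2)^2 = C^4 - C0^4 \<longleftrightarrow> R = R0" for R
      using \<alpha> by (auto simp: C assms(11) field_simps)
    ultimately have "R > 0 \<and> (\<alpha> * R - C^2)^2 = C^4 - C0^4 \<longleftrightarrow> R = R0" for R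
      by auto
    then show "relative_equilibria M m A B A1 B1 C = {rest_point R0 0}"
      unfolding rel_eq by simp
    show "X_red M m A B A1 B1 C differentiable (at (rest_point R0 0))"
      and "linearization_multiplicity (X_red M m A B A1 B1 C) (rest_point R0 0) 0 = 2"
      using S.degenerate_linearization[of R0] C C0(2) assms(11) by simp_all
  next
    assume C: "C > C0"
    define d where "d = sqrt (C^4 - C0^4)"
    have "C0^4 < C^4" using C C0 by (intro power_strict_mono) auto
    then have d: "d > 0" "d^2 = C^4 - C0^4" by (simp_all add: d_def)
    have "d^2 < (C^2)^2" using C0(1) by (simp add: d(2))
    then have "d < C^2" by (rule power2_less_imp_less) simp
    have R: "\<alpha> * R1 = C^2 + d" "\<alpha> * R2 = C^2 - d"
      using \<alpha> by (simp_all add: assms(12,13) d_def)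
    have "\<alpha> * R2 > 0" "\<alpha> * R2 < \<alpha> * R1" using \<open>d < C^2\<close> d(1) R by auto
    then have R2: "R2 > 0" "R2 < R1" using \<alpha> by (simp_all add: zero_less_mult_iff)
    have roots: "R > 0 \<and> (\<alpha> * R - C^2)^2 = C^4 - C0^4 \<longleftrightarrow> R = R1 \<or> R = R2" for R
    proof -
      have "(\<alpha> * R - C^2)^2 = C^4 - C0^4 \<longleftrightarrow> \<alpha> * R - C^2 = d \<or> \<alpha> * R - C^2 = - d"
        unfolding d(2)[symmetric] by (rule power2_eq_iff)
      also have "\<dots> \<longleftrightarrow> \<alpha> * R = \<alpha> * R1 \<or> \<alpha> * R = \<alpha> * R2" unfolding R by auto
      finally show ?thesis using \<alpha> R2 by auto
    qed
    then show "relative_equilibria M m A B A1 B1 C = {rest_point R1 0, rest_point R2 0}"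
      unfolding rel_eq by auto
    have U_R: "S.U_R R 0 = \<alpha> * (R - R1) * (R - R2) / (M * R^4)" if "R > 0" for R
    proof -
      have "(\<alpha> * R - C^2)^2 - (C^4 - 3 * \<alpha> * \<beta>) = (\<alpha> * R - \<alpha> * R1) * (\<alpha> * R - \<alpha> * R2)"
        unfolding R C0(2)[symmetric] d(2)[symmetric] by (simp add: algebra_simps power2_eq_square)
      also have "\<dots> = \<alpha> * (\<alpha> * (R - R1) * (R - R2))" by (simp add: algebra_simps)
      finally show ?thesis using S.U_R_collinear[OF that] \<alpha> by simp
    qed
    have decr: "S.U_R R 0 < 0" if "R2 < R" "R < R1" for R
      using that R2 \<alpha> assms(1) by (simp add: U_R divide_neg_pos mult_pos_neg mult_neg_pos)
    have incr: "S.U_R R 0 > 0" if "R1 < R" for R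
      using that R2 \<alpha> assms(1) by (simp add: U_R)
    show "rest_point R1 0 \<noteq> rest_point R2 0"
      using R2 rest_point_nth(1) by (metis less_irrefl)
    show "lyapunov_stable phase_space (X_red M m A B A1 B1 C) (rest_point R1 0)"
      using R2 decr incr by (intro S.lyapunov_stable_rest_point[of "R1 - R2"]) auto
    show "\<not> lyapunov_stable phase_space (X_red M m A B A1 B1 C) (rest_point R2 0)"
      using R2 decr by (intro S.not_lyapunov_stable_rest_point[of "(R1 - R2) / 2"]) (auto simp: field_simps)
  qed
qed

end
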